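(* $\gamma_6(K_1)=\frac{2}{3}$.
   Context: $K_1=\{(x_1,x_2,x_3)\in\mathbb{R}^3: |x_1|+|x_2|+|x_3|\le 1\}$ is the unit crosspolytope in three-dimensional Euclidean space $\mathbb{E}^3$. For a convex body (compact convex set with non-empty interior) $K\subset\mathbb{E}^n$ and a positive integer $m$, $\gamma_m(K)$ denotes the smallest positive number $\lambda$ such that $K$ can be covered by $m$ translates of $\lambda K$: $$\gamma_m(K)=\min\Big\{\lambda>0:\ \exists\,\boldsymbol u_1,\dots,\boldsymbol u_m\in\mathbb{E}^n \text{ such that } K\subseteq\bigcup_{i=1}^m(\lambda K+\boldsymbol u_i)\Big\}.$$ *)

theory Defs
  imports "HOL-Analysis.Analysis"
begin

definition crosspolytope3 :: "(real ^ 3) set" where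
  "crosspolytope3 = {x. \<bar>x $ 1\<bar> + \<bar>x $ 2\<bar> + \<bar>x $ 3\<bar> \<le> 1}"

definition homothetic_cover :: "nat \<Rightarrow> 'a::euclidean_space set \<Rightarrow> real \<Rightarrow> bool" where
  "homothetic_cover m K l \<longleftrightarrow>
     (\<exists>u :: nat \<Rightarrow> 'a. K \<subseteq> (\<Union>i\<in>{1..m}. (\<lambda>x. l *\<^sub>R x + u i) ` K))"

(* Intended for convex bodies K and m > 0.  LEAST is a genuine minimum: to establish a
   value of covering_gamma one has to show that it is attained. *)
definition covering_gamma :: "nat \<Rightarrow> 'a::euclidean_space set \<Rightarrow> real" where
  "covering_gamma m K = (LEAST l. l > 0 \<and> homothetic_cover m K l)"

end

theory Submission imports Defs begin

text \<open>
  The crosspolytope is the unit ball of the \<open>\<ell>\<^sub>1\<close> norm, so a translate of its multiple by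
  \<open>l\<close> is an \<open>\<ell>\<^sub>1\<close> ball of radius \<open>l\<close> and has diameter \<open>2 * l\<close>.

  Lower bound: the six vertices together with the centroid of one facet are seven points at mutual
  \<open>\<ell>\<^sub>1\<close> distance at least \<open>4/3\<close>. Six balls covering them put two of them into the same ball
  (\<open>separation_le_cover_diameter\<close>), hence \<open>4/3 \<le> 2 * l\<close>.

  Upper bound: six balls of radius \<open>2/3\<close> suffice, one centred a third of the way from the origin
  to each vertex. A point is covered by the ball belonging to its coordinate of largest absolute
  value (\<open>near_third_of_vertex\<close>).
\<close>

definition l1_norm :: "real ^ 3 \<Rightarrow> real" where
  "l1_norm x = \<bar>x $ 1\<bar> + \<bar>x $ 2\<bar> + \<bar>x $ 3\<bar>"

lemma l1_norm_triangle_diff: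
  "l1_norm (x - y) \<le> l1_norm (x - c) + l1_norm (y - c)"
  by (simp add: l1_norm_def)

lemma mem_translate_crosspolytope3_iff:
  assumes "l > 0"
  shows "p \<in> (\<lambda>x. l *\<^sub>R x + c) ` crosspolytope3 \<longleftrightarrow> l1_norm (p - c) \<le> l"
proof
  assume "p \<in> (\<lambda>x. l *\<^sub>R x + c) ` crosspolytope3"
  then obtain x where x: "l1_norm x \<le> 1" "p = l *\<^sub>R x + c"
    by (auto simp: crosspolytope3_def l1_norm_def)
  have "l1_norm (p - c) = l * l1_norm x"
    using assms x(2) by (simp add: l1_norm_def abs_mult distrib_left)
  then show "l1_norm (p - c) \<le> l"
    using assms x(1) by (simp add: mult_left_le)
next
  assume le: "l1_norm (p - c) \<le> l"
  have "l1_norm ((1 / l) *\<^sub>R (p - c)) = l1_norm (p - c) / l"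
    using assms by (simp add: l1_norm_def abs_mult add_divide_distrib)
  then have "(1 / l) *\<^sub>R (p - c) \<in> crosspolytope3"
    using assms le by (simp add: crosspolytope3_def flip: l1_norm_def)
  moreover have "p = l *\<^sub>R ((1 / l) *\<^sub>R (p - c)) + c"
    using assms by simp
  ultimately show "p \<in> (\<lambda>x. l *\<^sub>R x + c) ` crosspolytope3"
    by blast
qed

text \<open>By the pigeonhole principle two of the points share a translate, whose diameter is
  \<open>2 * l\<close>.\<close>

lemma separation_le_cover_diameter:
  assumes "l > 0" and cover: "homothetic_cover m crosspolytope3 l"
    and P: "P \<subseteq> crosspolytope3" "m < card P"
    and sep: "\<And>x y. x \<in> P \<Longrightarrow> y \<in> P \<Longrightarrow> x \<noteq> y \<Longrightarrow> d \<le> l1_norm (x - y)"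
  shows "d \<le> 2 * l"
proof -
  obtain u :: "nat \<Rightarrow> real ^ 3"
    where u: "crosspolytope3 \<subseteq> (\<Union>i\<in>{1..m}. (\<lambda>x. l *\<^sub>R x + u i) ` crosspolytope3)"
    using cover unfolding homothetic_cover_def by blast
  have "\<forall>p\<in>P. \<exists>i\<in>{1..m}. l1_norm (p - u i) \<le> l"
    using u P(1) mem_translate_crosspolytope3_iff[OF \<open>l > 0\<close>] by blast
  then obtain f where f: "\<And>p. p \<in> P \<Longrightarrow> f p \<in> {1..m} \<and> l1_norm (p - u (f p)) \<le> l"
    by metis
  have "card (f ` P) \<le> card {1..m}"
    using f by (intro card_mono) auto
  then have "\<not> inj_on f P"
    using P(2) card_image by fastforce
  then obtain x y where xy: "x \<in> P" "y \<in> P" "x \<noteq> y" "f x = f y"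
    unfolding inj_on_def by blast
  show ?thesis
    using sep[OF xy(1-3)] l1_norm_triangle_diff[of x y "u (f x)"] f[OF xy(1)] f[OF xy(2)] xy(4)
    by simp
qed

text \<open>The point \<open>(1/3, 1/3, 1/3)\<close> is at distance \<open>2/3 + 1/3 + 1/3 = 4/3\<close> from the
  vertices of its facet and at distance \<open>2\<close> from the others; two vertices are at distance \<open>2\<close>.\<close>

definition vertices_and_centroid :: "(real ^ 3) set" where
  "vertices_and_centroid =
    {vector [1, 0, 0], vector [-1, 0, 0], vector [0, 1, 0], vector [0, -1, 0],
     vector [0, 0, 1], vector [0, 0, -1], vector [1/3, 1/3, 1/3]}"

lemma vertices_and_centroid_subset: "vertices_and_centroid \<subseteq> crosspolytope3"
  by (simp add: vertices_and_centroid_def crosspolytope3_def)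

lemma card_vertices_and_centroid: "card vertices_and_centroid = 7"
  by (simp add: vertices_and_centroid_def vec_eq_iff forall_3)

lemma vertices_and_centroid_separated:
  assumes "x \<in> vertices_and_centroid" "y \<in> vertices_and_centroid" "x \<noteq> y"
  shows "4 / 3 \<le> l1_norm (x - y)"
  using assms unfolding vertices_and_centroid_def
  by (elim insertE emptyE) (simp_all add: l1_norm_def)

text \<open>If \<open>a\<close> is at least \<open>1/3\<close>, moving it by \<open>1/3\<close> towards \<open>0\<close> lowers the norm to at most
  \<open>2/3\<close>. Otherwise \<open>1/3 - a + \<bar>b\<bar> \<le> 1/3\<close> because \<open>\<bar>b\<bar> \<le> a\<close>, and
  \<open>\<bar>c\<bar> \<le> a < 1/3\<close>.\<close>

lemma near_third_of_vertex:
  fixes a b c :: real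
  assumes "\<bar>a\<bar> + \<bar>b\<bar> + \<bar>c\<bar> \<le> 1" "\<bar>b\<bar> \<le> a" "\<bar>c\<bar> \<le> a"
  shows "\<bar>a - 1/3\<bar> + \<bar>b\<bar> + \<bar>c\<bar> \<le> 2/3"
  using assms by linarith

lemma near_third_of_opposite_vertex:
  fixes a b c :: real
  assumes "\<bar>a\<bar> + \<bar>b\<bar> + \<bar>c\<bar> \<le> 1" "\<bar>b\<bar> \<le> - a" "\<bar>c\<bar> \<le> - a"
  shows "\<bar>a + 1/3\<bar> + \<bar>b\<bar> + \<bar>c\<bar> \<le> 2/3"
  using assms by linarith

lemma homothetic_cover_two_thirds: "homothetic_cover 6 crosspolytope3 (2/3)"
proof -
  define u :: "nat \<Rightarrow> real ^ 3" where
    "u i = [vector [1/3, 0, 0], vector [-1/3, 0, 0], vector [0, 1/3, 0], vector [0, -1/3, 0],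
            vector [0, 0, 1/3], vector [0, 0, -1/3]] ! (i - 1)" for i
  have "\<exists>i\<in>{1..6}. l1_norm (x - u i) \<le> 2/3" if "x \<in> crosspolytope3" for x
  proof -
    have x: "\<bar>x $ 1\<bar> + \<bar>x $ 2\<bar> + \<bar>x $ 3\<bar> \<le> 1"
      using that by (simp add: crosspolytope3_def)
    consider "\<bar>x $ 2\<bar> \<le> x $ 1" "\<bar>x $ 3\<bar> \<le> x $ 1" | "\<bar>x $ 2\<bar> \<le> - x $ 1" "\<bar>x $ 3\<bar> \<le> - x $ 1"
      | "\<bar>x $ 1\<bar> \<le> x $ 2" "\<bar>x $ 3\<bar> \<le> x $ 2" | "\<bar>x $ 1\<bar> \<le> - x $ 2" "\<bar>x $ 3\<bar> \<le> - x $ 2"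
      | "\<bar>x $ 1\<bar> \<le> x $ 3" "\<bar>x $ 2\<bar> \<le> x $ 3" | "\<bar>x $ 1\<bar> \<le> - x $ 3" "\<bar>x $ 2\<bar> \<le> - x $ 3"
      by linarith
    then show ?thesis
    proof cases
      case 1
      then have "l1_norm (x - u 1) \<le> 2/3"
        using x near_third_of_vertex[of "x $ 1" "x $ 2" "x $ 3"] by (simp add: u_def l1_norm_def)
      then show ?thesis by (intro bexI[of _ 1]) auto
    next
      case 2
      then have "l1_norm (x - u 2) \<le> 2/3"
        using x near_third_of_opposite_vertex[of "x $ 1" "x $ 2" "x $ 3"] by (simp add: u_def l1_norm_def)
      then show ?thesis by (intro bexI[of _ 2]) auto
    next
      case 3
      then have "l1_norm (x - u 3) \<le> 2/3"
        using x near_third_of_vertex[of "x $ 2" "x $ 1" "x $ 3"] by (simp add: u_def l1_norm_def)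
      then show ?thesis by (intro bexI[of _ 3]) auto
    next
      case 4
      then have "l1_norm (x - u 4) \<le> 2/3"
        using x near_third_of_opposite_vertex[of "x $ 2" "x $ 1" "x $ 3"] by (simp add: u_def l1_norm_def)
      then show ?thesis by (intro bexI[of _ 4]) auto
    next
      case 5
      then have "l1_norm (x - u 5) \<le> 2/3"
        using x near_third_of_vertex[of "x $ 3" "x $ 1" "x $ 2"] by (simp add: u_def l1_norm_def)
      then show ?thesis by (intro bexI[of _ 5]) auto
    next
      case 6
      then have "l1_norm (x - u 6) \<le> 2/3"
        using x near_third_of_opposite_vertex[of "x $ 3" "x $ 1" "x $ 2"] by (simp add: u_def l1_norm_def)
      then show ?thesis by (intro bexI[of _ 6]) auto
    qed
  qed
  then have "crosspolytope3 \<subseteq> (\<Union>i\<in>{1..6}. (\<lambda>x. (2/3) *\<^sub>R x + u i) ` crosspolytope3)"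
    using mem_translate_crosspolytope3_iff[of "2/3", OF divide_pos_pos[OF zero_less_numeral zero_less_numeral]] by blast
  then show ?thesis
    unfolding homothetic_cover_def by blast
qed

theorem theorem1p2: "covering_gamma 6 crosspolytope3 = 2 / 3"
  unfolding covering_gamma_def
proof (rule Least_equality)
  show "(2 / 3 :: real) > 0 \<and> homothetic_cover 6 crosspolytope3 (2 / 3)"
    using homothetic_cover_two_thirds by simp
next
  fix l :: real
  assume l: "l > 0 \<and> homothetic_cover 6 crosspolytope3 l"
  have "6 < card vertices_and_centroid"
    by (simp add: card_vertices_and_centroid)
  then have "4 / 3 \<le> 2 * l"
    using separation_le_cover_diameter[OF conjunct1[OF l] conjunct2[OF l]
        vertices_and_centroid_subset _ vertices_and_centroid_separated]
    by blast
  then show "2 / 3 \<le> l" by simp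
qed

end
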